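(* Let $H=(V,E,w)$ be a hypergraph with Laplacian operator $L$ and stationary distribution $\mu^*$. Then there exist a nonzero vector $v\in\mathbb{R}^n$ and $\lambda\in\mathbb{R}$ such that $\langle v,\mu^*\rangle=0$ and $L(v)=\lambda v$.
   Context: A hypergraph $H=(V,E,w)$ has vertex set $V$ with $|V|=n$, hyperedges $E\subseteq 2^V\setminus\{\emptyset\}$, positive weights $w$, and degrees $d_v=\sum_{e\ni v}w(e)$. Markov operator $M$: given $X\in\mathbb{R}^n$, for each hyperedge $e$ let $S_e$ (resp. $R_e$) be the set of vertices of $e$ where $X$ attains its maximum (resp. minimum) over $e$; form the weighted graph $G_X$ on $V$ with, for each $e$, edges between all pairs in $S_e\times R_e$ of weight $w(e)/(|S_e||R_e|)$, plus self-loops so that each vertex $v$ has weighted degree $d_v$; $A_X$ is the random-walk matrix of $G_X$ (row $i$ of the adjacency matrix divided by $d_i$), and $M(X)=A_XX$. The Laplacian is $L(X)=X-M(X)$. The stationary distribution is $\mu^*(i)=d_i/\sum_{j\in V}d_j$.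
   Formalization: The hypergraph is assumed to have at least two vertices (n ≥ 2); for n = 1 with the single hyperedge {v} one has μ* = 1, so no nonzero vector is orthogonal to μ* and the claim fails. *)

theory Defs
  imports "HOL-Analysis.Analysis"
begin

text \<open>
  The vertex set is the finite type \<open>'n\<close>, so that vectors in \<open>\<real>\<^sup>n\<close> are of type \<^typ>\<open>real ^ 'n\<close>.
  Only the values of \<open>w\<close> on \<open>E\<close> matter.
\<close>

definition hypergraph :: "'n::finite set set \<Rightarrow> ('n set \<Rightarrow> real) \<Rightarrow> bool" where
  "hypergraph E w \<longleftrightarrow> {} \<notin> E \<and> (\<forall>e\<in>E. w e > 0)"

definition degree :: "'n::finite set set \<Rightarrow> ('n set \<Rightarrow> real) \<Rightarrow> 'n \<Rightarrow> real" where
  "degree E w v = (\<Sum>e\<in>{e\<in>E. v \<in> e}. w e)"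

definition max_vertices :: "real ^ 'n::finite \<Rightarrow> 'n set \<Rightarrow> 'n set" where
  "max_vertices X e = {v\<in>e. \<forall>u\<in>e. X $ u \<le> X $ v}"

definition min_vertices :: "real ^ 'n::finite \<Rightarrow> 'n set \<Rightarrow> 'n set" where
  "min_vertices X e = {v\<in>e. \<forall>u\<in>e. X $ v \<le> X $ u}"

text \<open>
  The graph \<open>G\<^sub>X\<close> is undirected: a pair in \<open>S\<^sub>e \<times> R\<^sub>e\<close> is an edge regardless of its orientation, and
  it is counted once even if both orientations lie in \<open>S\<^sub>e \<times> R\<^sub>e\<close>. The latter happens only when
  \<open>X\<close> is constant on \<open>e\<close>, in which case these edges do not influence \<open>M(X)\<close>.
\<close>

definition pair_weight :: "('n::finite set \<Rightarrow> real) \<Rightarrow> real ^ 'n \<Rightarrow> 'n set \<Rightarrow> 'n \<Rightarrow> 'n \<Rightarrow> real" where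
  "pair_weight w X e u v =
     (let S = max_vertices X e; R = min_vertices X e
      in if (u, v) \<in> S \<times> R \<or> (v, u) \<in> S \<times> R
         then w e / (real (card S) * real (card R)) else 0)"

definition pair_adjacency ::
    "'n::finite set set \<Rightarrow> ('n set \<Rightarrow> real) \<Rightarrow> real ^ 'n \<Rightarrow> 'n \<Rightarrow> 'n \<Rightarrow> real" where
  "pair_adjacency E w X u v = (\<Sum>e\<in>E. pair_weight w X e u v)"

text \<open>A self-loop contributes its weight once to the degree of its vertex.\<close>

definition graph_adjacency ::
    "'n::finite set set \<Rightarrow> ('n set \<Rightarrow> real) \<Rightarrow> real ^ 'n \<Rightarrow> 'n \<Rightarrow> 'n \<Rightarrow> real" where
  "graph_adjacency E w X u v = pair_adjacency E w X u v +
     (if u = v then degree E w u - (\<Sum>x\<in>UNIV. pair_adjacency E w X u x) else 0)"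

lemma graph_adjacency_sym: "graph_adjacency E w X u v = graph_adjacency E w X v u"
  unfolding graph_adjacency_def pair_adjacency_def pair_weight_def Let_def
  by (auto intro!: sum.cong)

lemma graph_adjacency_degree: "(\<Sum>v\<in>UNIV. graph_adjacency E w X u v) = degree E w u"
  by (simp add: graph_adjacency_def sum.distrib)

text \<open>Division by zero makes the row of a vertex that lies in no hyperedge zero.\<close>

definition walk_matrix ::
    "'n::finite set set \<Rightarrow> ('n set \<Rightarrow> real) \<Rightarrow> real ^ 'n \<Rightarrow> real ^ 'n ^ 'n" where
  "walk_matrix E w X = (\<chi> i j. graph_adjacency E w X i j / degree E w i)"

definition markov_operator ::
    "'n::finite set set \<Rightarrow> ('n set \<Rightarrow> real) \<Rightarrow> real ^ 'n \<Rightarrow> real ^ 'n" where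
  "markov_operator E w X = walk_matrix E w X *v X"

definition laplacian ::
    "'n::finite set set \<Rightarrow> ('n set \<Rightarrow> real) \<Rightarrow> real ^ 'n \<Rightarrow> real ^ 'n" where
  "laplacian E w X = X - markov_operator E w X"

definition stationary_distribution ::
    "'n::finite set set \<Rightarrow> ('n set \<Rightarrow> real) \<Rightarrow> real ^ 'n" where
  "stationary_distribution E w = (\<chi> i. degree E w i / (\<Sum>j\<in>UNIV. degree E w j))"

end

theory Submission
  imports Defs
begin

text \<open>
  If some vertex has degree zero, its unit vector is an eigenvector for the eigenvalue \<open>1\<close>.
  Otherwise let \<open>f(X) = \<Sum>\<^sub>e w(e) (max\<^sub>e X - min\<^sub>e X)\<^sup>2\<close> and \<open>q(X) = \<Sum>\<^sub>i d\<^sub>i X\<^sub>i\<^sup>2\<close>. The function \<open>f\<close> is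
  convex and \<open>2 (d\<^sub>i L(X)\<^sub>i)\<^sub>i\<close> is one of its subgradients at \<open>X\<close>, whatever the ties. At a maximum of
  \<open>f / q\<close> on the orthogonal complement of \<open>\<mu>\<^sup>*\<close>, \<open>f\<close> touches \<open>\<Lambda> q\<close> from below, so every subgradient of
  \<open>f\<close> must coincide with the gradient of \<open>\<Lambda> q\<close>, so that \<open>L(X) = \<Lambda> X\<close>. (A minimum would only
  give \<open>\<Lambda> X\<close> from some subgradient, not necessarily the one chosen by \<open>L\<close>.)
\<close>

section \<open>Spread over a hyperedge and the energy\<close>

definition spread :: "real ^ 'n::finite \<Rightarrow> 'n set \<Rightarrow> real" where
  "spread X e = Max ((\<lambda>(i, j). X $ i - X $ j) ` (e \<times> e))"

definition energy :: "'n::finite set set \<Rightarrow> ('n set \<Rightarrow> real) \<Rightarrow> real ^ 'n \<Rightarrow> real" where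
  "energy E w X = (\<Sum>e\<in>E. w e * (spread X e)\<^sup>2)"

definition degree_inner ::
    "'n::finite set set \<Rightarrow> ('n set \<Rightarrow> real) \<Rightarrow> real ^ 'n \<Rightarrow> real ^ 'n \<Rightarrow> real" where
  "degree_inner E w X Y = (\<Sum>i\<in>UNIV. degree E w i * X $ i * Y $ i)"

lemma diff_le_spread: "i \<in> e \<Longrightarrow> j \<in> e \<Longrightarrow> X $ i - X $ j \<le> spread X e"
  unfolding spread_def by (rule Max_ge) auto

lemma spread_nonneg: "e \<noteq> {} \<Longrightarrow> 0 \<le> spread X e"
  using diff_le_spread[of _ e _ X] by fastforce

lemma spread_eq:
  assumes "i \<in> max_vertices X e" "j \<in> min_vertices X e"
  shows "spread X e = X $ i - X $ j"
  unfolding spread_def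
  by (rule Max_eqI) (use assms in \<open>auto simp: max_vertices_def min_vertices_def intro: diff_mono\<close>)

lemma max_vertices_nonempty:
  assumes "e \<noteq> {}"
  shows "max_vertices X e \<noteq> {}"
proof -
  have "Max (($) X ` e) \<in> ($) X ` e"
    using assms by (intro Max_in) auto
  then obtain i where "i \<in> e" "X $ i = Max (($) X ` e)"
    by auto
  then have "i \<in> max_vertices X e"
    by (auto simp: max_vertices_def)
  then show ?thesis by blast
qed

lemma min_vertices_nonempty:
  assumes "e \<noteq> {}"
  shows "min_vertices X e \<noteq> {}"
proof -
  have "Min (($) X ` e) \<in> ($) X ` e"
    using assms by (intro Min_in) auto
  then obtain i where "i \<in> e" "X $ i = Min (($) X ` e)"
    by auto
  then have "i \<in> min_vertices X e"
    by (auto simp: min_vertices_def)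
  then show ?thesis by blast
qed

lemma spread_scaleR:
  assumes "e \<noteq> {}" "0 \<le> c"
  shows "spread (c *\<^sub>R X) e = c * spread X e"
proof -
  obtain i j where ij: "i \<in> max_vertices X e" "j \<in> min_vertices X e"
    using max_vertices_nonempty min_vertices_nonempty assms(1) by blast
  then have "i \<in> max_vertices (c *\<^sub>R X) e" "j \<in> min_vertices (c *\<^sub>R X) e"
    using assms(2) by (auto simp: max_vertices_def min_vertices_def intro: mult_left_mono)
  with ij show ?thesis
    by (simp add: spread_eq right_diff_distrib)
qed

lemma continuous_on_Max_image:
  fixes f :: "'i \<Rightarrow> 'a::topological_space \<Rightarrow> 'b::linorder_topology"
  assumes "finite I" "I \<noteq> {}" "\<And>i. i \<in> I \<Longrightarrow> continuous_on A (f i)"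
  shows "continuous_on A (\<lambda>x. Max ((\<lambda>i. f i x) ` I))"
  using assms
  by (induction rule: finite_ne_induct) (auto intro!: continuous_on_max)

text \<open>A maximum of finitely many linear functions of \<open>X\<close> is continuous; this is
  why \<open>spread\<close> is a maximum over \<open>e \<times> e\<close>, independent of the tie
  sets, which jump with \<open>X\<close>.\<close>

lemma continuous_on_spread:
  assumes "e \<noteq> {}"
  shows "continuous_on A (\<lambda>X. spread X e)"
  unfolding spread_def case_prod_beta
  using assms by (intro continuous_on_Max_image) (auto intro!: continuous_intros)

lemma continuous_on_energy:
  "hypergraph E w \<Longrightarrow> continuous_on A (energy E w)"
  unfolding energy_def[abs_def] hypergraph_def
  by (intro continuous_intros continuous_on_spread) auto

text \<open>Homogeneity of degree 2 makes the quotient by \<open>degree_inner E w X X\<close>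
  invariant under positive scaling, so it can be maximized on the unit sphere.\<close>

lemma energy_scaleR:
  assumes "hypergraph E w" "0 \<le> c"
  shows "energy E w (c *\<^sub>R X) = c\<^sup>2 * energy E w X"
  unfolding energy_def sum_distrib_left
  using assms by (intro sum.cong refl)
    (metis hypergraph_def mult.left_commute power_mult_distrib spread_scaleR)

section \<open>Pairing the Laplacian with a vector\<close>

lemma pair_weight_mult_diff:
  "pair_weight w X e i j * (X $ i - X $ j) =
     w e / (real (card (max_vertices X e)) * real (card (min_vertices X e))) * spread X e *
     (of_bool (i \<in> max_vertices X e \<and> j \<in> min_vertices X e)
      - of_bool (j \<in> max_vertices X e \<and> i \<in> min_vertices X e))"
proof -
  consider (neither) "\<not> (i \<in> max_vertices X e \<and> j \<in> min_vertices X e)"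
      "\<not> (j \<in> max_vertices X e \<and> i \<in> min_vertices X e)"
    | (one) "i \<in> max_vertices X e" "j \<in> min_vertices X e"
      "\<not> (j \<in> max_vertices X e \<and> i \<in> min_vertices X e)"
    | (other) "\<not> (i \<in> max_vertices X e \<and> j \<in> min_vertices X e)"
      "j \<in> max_vertices X e" "i \<in> min_vertices X e"
    | (both) "i \<in> max_vertices X e" "j \<in> min_vertices X e"
      "j \<in> max_vertices X e" "i \<in> min_vertices X e"
    by blast
  then show ?thesis
  proof cases
    case neither
    then show ?thesis by (auto simp: pair_weight_def Let_def)
  next
    case one
    then show ?thesis using spread_eq[of i X e j]
      by (auto simp: pair_weight_def Let_def)
  next
    case other
    then show ?thesis using spread_eq[of j X e i]
      by (auto simp: pair_weight_def Let_def right_diff_distrib)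
  next
    case both
    \<comment> \<open>The spread equals both this difference and its negative. The two indicators
      cancel on the right, so counting such a pair once does no harm.\<close>
    then have "X $ i = X $ j"
      using spread_eq[of i X e j] spread_eq[of j X e i] by simp
    with both show ?thesis by simp
  qed
qed

lemma sum_pair_weight:
  "(\<Sum>i\<in>UNIV. \<Sum>j\<in>UNIV. pair_weight w X e i j * (X $ i - X $ j) * Y $ i) =
     w e / (real (card (max_vertices X e)) * real (card (min_vertices X e))) * spread X e *
     (\<Sum>i\<in>max_vertices X e. \<Sum>j\<in>min_vertices X e. Y $ i - Y $ j)"
proof -
  let ?S = "max_vertices X e" and ?R = "min_vertices X e"
  let ?c = "w e / (real (card ?S) * real (card ?R)) * spread X e"
  have indicator: "(\<Sum>i\<in>UNIV. \<Sum>j\<in>UNIV. of_bool (i \<in> A \<and> j \<in> B) * h i j)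
      = (\<Sum>i\<in>A. \<Sum>j\<in>B. h i j)" for A B :: "'a set" and h :: "'a \<Rightarrow> 'a \<Rightarrow> real"
    by (simp add: of_bool_conj mult.assoc flip: sum_distrib_left)
  have "(\<Sum>i\<in>UNIV. \<Sum>j\<in>UNIV. pair_weight w X e i j * (X $ i - X $ j) * Y $ i) =
      ?c * ((\<Sum>i\<in>UNIV. \<Sum>j\<in>UNIV. of_bool (i \<in> ?S \<and> j \<in> ?R) * Y $ i) -
            (\<Sum>i\<in>UNIV. \<Sum>j\<in>UNIV. of_bool (j \<in> ?S \<and> i \<in> ?R) * Y $ i))"
    unfolding pair_weight_mult_diff sum_distrib_left sum_subtractf[symmetric]
    by (intro sum.cong refl) (simp add: algebra_simps)
  \<comment> \<open>Exchanging the summation variables puts both sums on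
    \<open>?S \<times> ?R\<close>, where they combine to \<open>Y $ i - Y $ j\<close>.\<close>
  also have "(\<Sum>i\<in>UNIV. \<Sum>j\<in>UNIV. of_bool (j \<in> ?S \<and> i \<in> ?R) * Y $ i)
      = (\<Sum>i\<in>UNIV. \<Sum>j\<in>UNIV. of_bool (i \<in> ?S \<and> j \<in> ?R) * Y $ j)"
    by (rule sum.swap)
  finally show ?thesis
    unfolding indicator by (simp add: sum_subtractf)
qed

lemma sum_pair_weight_self:
  assumes "e \<noteq> {}"
  shows "(\<Sum>i\<in>UNIV. \<Sum>j\<in>UNIV. pair_weight w X e i j * (X $ i - X $ j) * X $ i)
    = w e * (spread X e)\<^sup>2"
proof -
  have "(\<Sum>i\<in>max_vertices X e. \<Sum>j\<in>min_vertices X e. X $ i - X $ j)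
      = (\<Sum>i\<in>max_vertices X e. \<Sum>j\<in>min_vertices X e. spread X e)"
    by (intro sum.cong refl) (simp add: spread_eq)
  then show ?thesis
    using max_vertices_nonempty[OF assms, of X] min_vertices_nonempty[OF assms, of X]
    unfolding sum_pair_weight by (simp add: power2_eq_square card_eq_0_iff)
qed

text \<open>Each difference of \<open>Y\<close> over a pair in \<open>?S \<times> ?R\<close> is at
  most its spread, and the number of pairs cancels the normalization of the weight. For
  \<open>Y = X\<close> every difference attains the spread, which gives the preceding
  equality.\<close>

lemma sum_pair_weight_le:
  assumes "e \<noteq> {}" "0 \<le> w e"
  shows "(\<Sum>i\<in>UNIV. \<Sum>j\<in>UNIV. pair_weight w X e i j * (X $ i - X $ j) * Y $ i)
    \<le> w e * (spread X e * spread Y e)"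
proof -
  let ?S = "max_vertices X e" and ?R = "min_vertices X e"
  have "(\<Sum>i\<in>?S. \<Sum>j\<in>?R. Y $ i - Y $ j) \<le> (\<Sum>i\<in>?S. \<Sum>j\<in>?R. spread Y e)"
    by (intro sum_mono diff_le_spread) (auto simp: max_vertices_def min_vertices_def)
  then have "w e / (real (card ?S) * real (card ?R)) * spread X e *
        (\<Sum>i\<in>?S. \<Sum>j\<in>?R. Y $ i - Y $ j)
      \<le> w e / (real (card ?S) * real (card ?R)) * spread X e * (\<Sum>i\<in>?S. \<Sum>j\<in>?R. spread Y e)"
    using assms by (intro mult_left_mono mult_nonneg_nonneg divide_nonneg_nonneg spread_nonneg) auto
  also have "\<dots> = w e * (spread X e * spread Y e)"
    using max_vertices_nonempty[OF assms(1), of X] min_vertices_nonempty[OF assms(1), of X]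
    by (simp add: card_eq_0_iff)
  finally show ?thesis
    unfolding sum_pair_weight .
qed

text \<open>The self-loop complements row \<open>i\<close> to total weight
  \<open>degree E w i\<close>, so the diagonal part of \<open>X - M(X)\<close> turns each entry into
  a difference.\<close>

lemma laplacian_nth:
  assumes "degree E w i \<noteq> 0"
  shows "degree E w i * laplacian E w X $ i
    = (\<Sum>j\<in>UNIV. pair_adjacency E w X i j * (X $ i - X $ j))"
proof -
  have "degree E w i * markov_operator E w X $ i = (\<Sum>j\<in>UNIV. graph_adjacency E w X i j * X $ j)"
    using assms
    by (simp add: markov_operator_def walk_matrix_def matrix_vector_mult_def sum_distrib_left)
  also have "\<dots> = (\<Sum>j\<in>UNIV. pair_adjacency E w X i j * X $ j)
      + (degree E w i - (\<Sum>j\<in>UNIV. pair_adjacency E w X i j)) * X $ i"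
    by (simp add: graph_adjacency_def distrib_right sum.distrib if_distrib[of "\<lambda>x. x * _"]
        cong: if_cong)
  finally show ?thesis
    by (simp add: laplacian_def algebra_simps sum_subtractf sum_distrib_left)
qed

lemma degree_inner_laplacian:
  assumes "\<And>i. degree E w i \<noteq> 0"
  shows "degree_inner E w (laplacian E w X) Y =
    (\<Sum>e\<in>E. \<Sum>i\<in>UNIV. \<Sum>j\<in>UNIV. pair_weight w X e i j * (X $ i - X $ j) * Y $ i)"
proof -
  have "degree_inner E w (laplacian E w X) Y =
      (\<Sum>i\<in>UNIV. \<Sum>j\<in>UNIV. \<Sum>e\<in>E. pair_weight w X e i j * (X $ i - X $ j) * Y $ i)"
    unfolding degree_inner_def laplacian_nth[OF assms] pair_adjacency_def
    by (simp add: sum_distrib_right)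
  also have "\<dots> = (\<Sum>i\<in>UNIV. \<Sum>e\<in>E. \<Sum>j\<in>UNIV. pair_weight w X e i j * (X $ i - X $ j) * Y $ i)"
    by (intro sum.cong refl sum.swap)
  also have "\<dots> = (\<Sum>e\<in>E. \<Sum>i\<in>UNIV. \<Sum>j\<in>UNIV. pair_weight w X e i j * (X $ i - X $ j) * Y $ i)"
    by (rule sum.swap)
  finally show ?thesis .
qed

lemma degree_inner_laplacian_self:
  assumes "hypergraph E w" "\<And>i. degree E w i \<noteq> 0"
  shows "degree_inner E w (laplacian E w X) X = energy E w X"
  unfolding degree_inner_laplacian[OF assms(2)] energy_def
  using assms(1) by (intro sum.cong refl sum_pair_weight_self) (auto simp: hypergraph_def)

text \<open>This is f(Y) \<ge> f(X) + 2 <L(X), Y - X> for the energy f, rewritten with <L(X), X> =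
  f(X). It follows hyperedge by hyperedge from 2ab \<le> a^2 + b^2.\<close>

lemma energy_subgradient:
  assumes "hypergraph E w" "\<And>i. degree E w i \<noteq> 0"
  shows "2 * degree_inner E w (laplacian E w X) Y \<le> energy E w X + energy E w Y"
proof -
  have "degree_inner E w (laplacian E w X) Y \<le> (\<Sum>e\<in>E. w e * (spread X e * spread Y e))"
    unfolding degree_inner_laplacian[OF assms(2)]
    using assms(1) by (intro sum_mono sum_pair_weight_le) (auto simp: hypergraph_def less_imp_le)
  then have "2 * degree_inner E w (laplacian E w X) Y
      \<le> 2 * (\<Sum>e\<in>E. w e * (spread X e * spread Y e))"
    by simp
  also have "\<dots> = (\<Sum>e\<in>E. w e * (2 * spread X e * spread Y e))"
    by (simp add: sum_distrib_left mult_ac)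
  also have "\<dots> \<le> (\<Sum>e\<in>E. w e * ((spread X e)\<^sup>2 + (spread Y e)\<^sup>2))"
    using assms(1) by (intro sum_mono mult_left_mono sum_squares_bound)
      (auto simp: hypergraph_def less_imp_le)
  finally show ?thesis
    by (simp add: energy_def distrib_left sum.distrib)
qed

text \<open>Differences of a constant vector vanish. Hence multiples of
  \<open>laplacian E w X\<close> are admissible competitors in the maximization.\<close>

lemma degree_inner_laplacian_one:
  assumes "\<And>i. degree E w i \<noteq> 0"
  shows "degree_inner E w (laplacian E w X) 1 = 0"
  unfolding degree_inner_laplacian[OF assms] sum_pair_weight by simp

section \<open>The degree-weighted inner product\<close>

lemma inner_stationary_distribution:
  "X \<bullet> stationary_distribution E w = degree_inner E w X 1 / (\<Sum>j\<in>UNIV. degree E w j)"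
  by (simp add: inner_vec_def stationary_distribution_def degree_inner_def sum_divide_distrib
      mult.commute)

lemma degree_inner_pos:
  assumes "\<And>i. 0 < degree E w i" "X \<noteq> 0"
  shows "0 < degree_inner E w X X"
proof -
  obtain i where "X $ i \<noteq> 0"
    using assms(2) by (auto simp: vec_eq_iff)
  then have "0 < degree E w i * X $ i * X $ i"
    using assms(1)[of i] by (auto simp: mult.assoc zero_less_mult_iff linorder_neq_iff)
  then show ?thesis
    unfolding degree_inner_def using assms(1)
    by (intro sum_pos2[where i = i]) (auto simp: mult.assoc less_imp_le)
qed

lemma degree_inner_simps:
  "degree_inner E w (X - Y) Z = degree_inner E w X Z - degree_inner E w Y Z"
  "degree_inner E w Z (X - Y) = degree_inner E w Z X - degree_inner E w Z Y"
  "degree_inner E w (c *\<^sub>R X) Z = c * degree_inner E w X Z"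
  "degree_inner E w Z (c *\<^sub>R X) = c * degree_inner E w Z X"
  by (simp_all add: degree_inner_def algebra_simps sum_subtractf sum_distrib_left)

lemma degree_inner_commute: "degree_inner E w X Y = degree_inner E w Y X"
  by (simp add: degree_inner_def mult_ac)

section \<open>Existence of a maximizer of the energy quotient\<close>

lemma exists_orthogonal_nonzero:
  fixes u :: "real ^ 'n::finite"
  assumes "CARD('n) \<ge> 2"
  obtains X :: "real ^ 'n" where "X \<noteq> 0" "X \<bullet> u = 0"
proof -
  have "\<not> CARD('n) \<le> Suc 0"
    using assms by simp
  then obtain i j :: 'n where ij: "i \<noteq> j"
    by (auto simp: card_le_Suc0_iff_eq)
  show ?thesis
  proof (cases "u $ i = 0")
    case True
    then show ?thesis
      by (intro that[of "axis i 1"]) (auto simp: inner_axis')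
  next
    case False
    \<comment> \<open>The vector (u_i, u_j) rotated by a right angle in the plane of the coordinates
      \<open>i\<close> and \<open>j\<close>.\<close>
    let ?X = "u $ j *\<^sub>R axis i 1 - u $ i *\<^sub>R axis j 1 :: real ^ 'n"
    have "?X $ j \<noteq> 0"
      using ij False by (simp add: axis_def)
    then have "?X \<noteq> 0"
      by (metis zero_index)
    then show ?thesis
      by (rule that) (simp add: inner_diff_left inner_axis')
  qed
qed

text \<open>The quotient is continuous on the compact slice \<open>?K\<close> of the unit sphere and
  attains a maximum \<open>l\<close> there; scaling extends the bound to the whole
  hyperplane.\<close>

lemma energy_quotient_maximizer:
  fixes E :: "'n::finite set set"
  assumes "hypergraph E w" "\<And>i. 0 < degree E w i" "CARD('n) \<ge> 2"
  obtains X :: "real ^ 'n" and l where "X \<noteq> 0" "X \<bullet> u = 0"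
    "energy E w X = l * degree_inner E w X X"
    "\<And>Y. Y \<bullet> u = 0 \<Longrightarrow> energy E w Y \<le> l * degree_inner E w Y Y"
proof -
  let ?K = "sphere 0 1 \<inter> {X :: real ^ 'n. X \<bullet> u = 0}"
  let ?r = "\<lambda>X. energy E w X / degree_inner E w X X"
  have q: "0 < degree_inner E w X X" if "X \<noteq> 0" for X
    using degree_inner_pos[OF assms(2) that] .
  have normalized: "(1 / norm X) *\<^sub>R X \<in> ?K" if "X \<noteq> 0" "X \<bullet> u = 0" for X
    using that by simp
  obtain Z :: "real ^ 'n" where "Z \<noteq> 0" "Z \<bullet> u = 0"
    using exists_orthogonal_nonzero[OF assms(3)] .
  then have "?K \<noteq> {}"
    using normalized by blast
  moreover have "compact ?K"
    by (intro compact_Int_closed compact_sphere closed_Collect_eq) (auto intro!: continuous_intros)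
  moreover have "continuous_on ?K ?r"
  proof (intro continuous_on_divide continuous_on_energy assms(1))
    show "continuous_on ?K (\<lambda>X. degree_inner E w X X)"
      unfolding degree_inner_def by (intro continuous_intros)
    show "\<forall>X\<in>?K. degree_inner E w X X \<noteq> 0"
      by (metis IntD1 less_irrefl norm_zero mem_sphere_0 q zero_neq_one)
  qed
  ultimately obtain X where X: "X \<in> ?K" "\<And>Y. Y \<in> ?K \<Longrightarrow> ?r Y \<le> ?r X"
    using continuous_attains_sup[of ?K ?r] by blast
  then have "X \<noteq> 0" by auto
  have "energy E w Y \<le> ?r X * degree_inner E w Y Y" if "Y \<bullet> u = 0" for Y
  proof (cases "Y = 0")
    case True
    then show ?thesis
      \<comment> \<open>Scaling by 0 shows that the zero vector has energy 0.\<close>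
      using energy_scaleR[OF assms(1), of 0 Y] by (simp add: degree_inner_def)
  next
    case False
    then have "?r ((1 / norm Y) *\<^sub>R Y) \<le> ?r X"
      using X(2) normalized that by blast
    moreover have "?r ((1 / norm Y) *\<^sub>R Y) = ?r Y"
      using False by (simp add: energy_scaleR[OF assms(1)] degree_inner_simps power2_eq_square)
    ultimately show ?thesis
      using q[OF False] by (simp add: pos_divide_le_eq)
  qed
  moreover have "energy E w X = ?r X * degree_inner E w X X"
    using q[OF \<open>X \<noteq> 0\<close>] by simp
  ultimately show ?thesis
    using that[OF \<open>X \<noteq> 0\<close>, of "?r X"] X(1) by blast
qed

section \<open>A maximizer is an eigenvector\<close>

lemma laplacian_at_maximizer:
  assumes "hypergraph E w" "\<And>i. 0 < degree E w i"
    and "X \<noteq> 0"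
    and X: "energy E w X = l * degree_inner E w X X"
    and max: "\<And>Y. degree_inner E w Y 1 = 0 \<Longrightarrow> energy E w Y \<le> l * degree_inner E w Y Y"
  shows "laplacian E w X = l *\<^sub>R X"
proof (rule ccontr)
  let ?L = "laplacian E w X"
  assume neq: "?L \<noteq> l *\<^sub>R X"
  have deg: "degree E w i \<noteq> 0" for i
    using assms(2)[of i] by simp
  \<comment> \<open>The competitor \<open>t *\<^sub>R ?L\<close> bounds the energy from above by
    maximality and from below by the subgradient inequality.\<close>
  have test: "2 * t * degree_inner E w ?L ?L
      \<le> l * degree_inner E w X X + l * t\<^sup>2 * degree_inner E w ?L ?L" for t
    using energy_subgradient[OF assms(1) deg, of X "t *\<^sub>R ?L"] max[of "t *\<^sub>R ?L"] X
    by (simp add: degree_inner_simps degree_inner_laplacian_one[OF deg] power2_eq_square mult_ac)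
  have LX: "degree_inner E w ?L X = l * degree_inner E w X X"
    using degree_inner_laplacian_self[OF assms(1) deg] X by simp
  have "degree_inner E w ?L ?L \<le> l\<^sup>2 * degree_inner E w X X"
  proof (cases "l = 0")
    case True
    then show ?thesis using test[of 1] by simp
  next
    case False
    have "0 \<le> energy E w X"
      using assms(1) by (auto simp: energy_def hypergraph_def less_imp_le intro!: sum_nonneg)
    moreover have "0 < degree_inner E w X X"
      using degree_inner_pos[OF assms(2) \<open>X \<noteq> 0\<close>] .
    ultimately have "0 < l"
      using X False by (simp add: zero_le_mult_iff)
    then show ?thesis
      \<comment> \<open>The choice t = 1/l makes the quadratic inequality in t sharpest.\<close>
      using test[of "1 / l"] by (simp add: power2_eq_square field_simps)
  qed
  moreover have "0 < degree_inner E w (?L - l *\<^sub>R X) (?L - l *\<^sub>R X)"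
    using neq by (intro degree_inner_pos assms(2)) simp
  \<comment> \<open>Expanding the square with \<open>LX\<close> leaves <L(X), L(X)> - l^2 <X, X>,
    which was just shown to be at most 0.\<close>
  ultimately show False
    using LX by (simp add: degree_inner_simps degree_inner_commute[of E w X ?L] power2_eq_square)
qed

section \<open>Vertices of degree zero, and the conclusion\<close>

lemma degree_nonneg: "hypergraph E w \<Longrightarrow> 0 \<le> degree E w i"
  unfolding degree_def hypergraph_def by (intro sum_nonneg) (auto simp: less_imp_le)

lemma degree_eq_0_iff:
  assumes "hypergraph E w"
  shows "degree E w i = 0 \<longleftrightarrow> (\<forall>e\<in>E. i \<notin> e)"
  unfolding degree_def using assms
  by (subst sum_nonneg_eq_0_iff) (force simp: hypergraph_def)+

text \<open>Vertex \<open>k\<close> lies in no hyperedge and its self-loop has weight 0, so column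
  \<open>k\<close> of the walk matrix vanishes and the Markov operator kills the unit
  vector.\<close>

lemma laplacian_axis_isolated:
  assumes "hypergraph E w" "degree E w k = 0"
  shows "laplacian E w (axis k 1) = axis k 1"
proof -
  have "graph_adjacency E w (axis k 1) i k = 0" for i
  proof -
    have "pair_adjacency E w X i k = 0" "pair_adjacency E w X k i = 0" for X i
      using assms degree_eq_0_iff[OF assms(1), of k]
      by (auto simp: pair_adjacency_def pair_weight_def Let_def max_vertices_def min_vertices_def
          intro!: sum.neutral)
    then show ?thesis
      using assms(2) by (simp add: graph_adjacency_def)
  qed
  then have "markov_operator E w (axis k 1) = 0"
    by (simp add: markov_operator_def walk_matrix_def matrix_vector_mult_def vec_eq_iff axis_def
        if_distrib[of "\<lambda>x. _ * x"] cong: if_cong)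
  then show ?thesis
    by (simp add: laplacian_def)
qed

theorem theorem2p6:
  fixes E :: "'n::finite set set" and w :: "'n set \<Rightarrow> real"
  assumes "hypergraph E w" and "CARD('n) \<ge> 2"
  shows "\<exists>(v :: real ^ 'n) (l :: real).
           v \<noteq> 0 \<and> v \<bullet> stationary_distribution E w = 0 \<and> laplacian E w v = l *\<^sub>R v"
proof (cases "\<exists>k. degree E w k = 0")
  case True
  then obtain k where k: "degree E w k = 0" ..
  have "axis k 1 \<bullet> stationary_distribution E w = 0"
    using k by (simp add: inner_axis' stationary_distribution_def)
  then show ?thesis
    using laplacian_axis_isolated[OF assms(1) k]
    by (intro exI[of _ "axis k 1"] exI[of _ 1]) simp
next
  case False
  then have deg: "0 < degree E w i" for i
    using degree_nonneg[OF assms(1), of i] by (metis order_le_less)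
  obtain X l where "X \<noteq> 0" "X \<bullet> stationary_distribution E w = 0"
      "energy E w X = l * degree_inner E w X X"
      "\<And>Y. Y \<bullet> stationary_distribution E w = 0 \<Longrightarrow> energy E w Y \<le> l * degree_inner E w Y Y"
    using energy_quotient_maximizer[OF assms(1) deg assms(2), of "stationary_distribution E w"]
    by blast
  then show ?thesis
    using laplacian_at_maximizer[OF assms(1) deg, of X l]
    \<comment> \<open>Orthogonality to \<open>1\<close> in the degree form gives orthogonality to
      the stationary distribution, so the maximality bound applies.\<close>
    by (auto simp: inner_stationary_distribution)
qed

end
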